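(* Suppose the adjacency matrix $A$ on $n$ nodes is generated from the $K$-block stochastic block model with true parameter $\theta^*\in\Theta_K$, as described in the context, and let $K^+>K$ be a fixed integer. Then, as $n\to\infty$, $L_{K,K^+}=O_P(n^{3/2}\rho_n^{1/2})$.
   Context: Model. $[K]=\{1,\dots,K\}$, with $K$ fixed as $n\to\infty$. For $K'\ge1$, $\Theta_{K'}$ is the set of $\theta=(\pi,H)$ with $\pi\in(0,1)^{K'}$, $\sum_a\pi_a=1$ (for $K'=1$, $\pi=1$), and $H\in(0,1)^{K'\times K'}$ symmetric. Under $\theta^*=(\pi^*,H^* )\in\Theta_K$, the latent labels $Z=(Z_1,\dots,Z_n)\in[K]^n$ are i.i.d. with $P(Z_i=a)=\pi_a^*$; given $Z$, $A$ is a symmetric $0/1$ matrix with zero diagonal whose entries $A_{i,j}$, $i<j$, are independent Bernoulli$(H^*_{Z_i,Z_j})$. Write $H^*=\rho_nS^*$, where $\pi^*$ and the symmetric matrix $S^*$ with positive entries do not depend on $n$, and $H^*$ has no two identical columns. The degree density $\rho_n$ satisfies either $\rho_n=\Omega(1)$, or $\rho_n\to0$ with $n\rho_n/\log n\to\infty$. Likelihood. For $z\in[K']^n$ let $n_a(z)=\sum_i\mathbf 1(z_i=a)$, $n_{a,b}(z)=\sum_i\sum_{j\ne i}\mathbf 1(z_i=a,z_j=b)$, $O_{a,b}(z)=\sum_i\sum_{j\ne i}\mathbf 1(z_i=a,z_j=b)A_{i,j}$. For $\theta\in\Theta_{K'}$, $$f(z,A;\theta)=\Big(\prod_{a=1}^{K'}\pi_a^{n_a(z)}\Big)\Big(\prod_{a,b=1}^{K'}H_{a,b}^{O_{a,b}(z)}(1-H_{a,b})^{n_{a,b}(z)-O_{a,b}(z)}\Big)^{1/2},\qquad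 g(A;\theta)=\sum_{z\in[K']^n}f(z,A;\theta),$$ and the log likelihood ratio is $L_{K,K'}=\log\dfrac{\sup_{\theta\in\Theta_{K'}}g(A;\theta)}{\sup_{\theta\in\Theta_K}g(A;\theta)}$. $O_P$ is with respect to the law of $A$ under $\theta^*$. *)

theory Defs
  imports "HOL-Probability.Probability" "HOL-Library.Landau_Symbols"
begin

text \<open>
  Block labels are \<open>{1..K}\<close> and nodes are \<open>{1..n}\<close>. A parameter is a pair \<open>(\<pi>, H)\<close> of functions
  of which only the values at labels in \<open>{1..K}\<close> matter.
\<close>

type_synonym sbm_param = "(nat \<Rightarrow> real) \<times> (nat \<Rightarrow> nat \<Rightarrow> real)"

definition Theta :: "nat \<Rightarrow> sbm_param set" where
  "Theta K = {(\<pi>, H).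
     (if K = 1 then \<pi> 1 = 1
      else (\<forall>a\<in>{1..K}. \<pi> a \<in> {0<..<1}) \<and> (\<Sum>a\<in>{1..K}. \<pi> a) = 1) \<and>
     (\<forall>a\<in>{1..K}. \<forall>b\<in>{1..K}. H a b \<in> {0<..<1} \<and> H a b = H b a)}"

definition label_pmf :: "nat \<Rightarrow> (nat \<Rightarrow> real) \<Rightarrow> nat pmf" where
  "label_pmf K \<pi> = embed_pmf (\<lambda>a. if a \<in> {1..K} then \<pi> a else 0)"

text \<open>The side conditions of \<^const>\<open>embed_pmf\<close> hold for every admissible parameter.\<close>

lemma pmf_label_pmf:
  assumes "(\<pi>, H) \<in> Theta K" "K \<ge> 1"
  shows "pmf (label_pmf K \<pi>) a = (if a \<in> {1..K} then \<pi> a else 0)"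
  unfolding label_pmf_def
proof (rule pmf_embed_pmf)
  have nn: "0 \<le> \<pi> x" if "x \<in> {1..K}" for x
    using assms that by (auto simp: Theta_def less_imp_le split: if_splits)
  then show "0 \<le> (if x \<in> {1..K} then \<pi> x else 0)" for x
    by auto
  have s: "(\<Sum>a\<in>{1..K}. \<pi> a) = 1"
    using assms by (auto simp: Theta_def split: if_splits)
  have "(\<integral>\<^sup>+ x. ennreal (if x \<in> {1..K} then \<pi> x else 0) \<partial>count_space UNIV) =
        (\<Sum>x\<in>{1..K}. ennreal (if x \<in> {1..K} then \<pi> x else 0))"
    by (rule nn_integral_count_space') auto
  also have "\<dots> = (\<Sum>x\<in>{1..K}. ennreal (\<pi> x))"
    by (intro sum.cong) auto
  also have "\<dots> = 1"
    using nn s by (subst sum_ennreal) auto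
  finally show "(\<integral>\<^sup>+ x. ennreal (if x \<in> {1..K} then \<pi> x else 0) \<partial>count_space UNIV) = 1" .
qed

text \<open>
  The law of the adjacency matrix: the indicators of the pairs \<open>i < j\<close> are drawn independently
  given the labels. \<^const>\<open>Pi_pmf\<close> gives all other pairs the value \<^const>\<open>False\<close>, so reading the
  entry \<open>(i, j)\<close> at \<open>(min i j, max i j)\<close> yields a symmetric matrix with zero diagonal.
\<close>

definition sbm_pmf :: "nat \<Rightarrow> nat \<Rightarrow> sbm_param \<Rightarrow> (nat \<Rightarrow> nat \<Rightarrow> nat) pmf" where
  "sbm_pmf n K = (\<lambda>(\<pi>, H).
     bind_pmf (Pi_pmf {1..n} 0 (\<lambda>_. label_pmf K \<pi>)) (\<lambda>Z.
       map_pmf (\<lambda>E i j. of_bool (E (min i j, max i j)))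
         (Pi_pmf {(i, j). 1 \<le> i \<and> i < j \<and> j \<le> n} False
           (\<lambda>(i, j). bernoulli_pmf (H (Z i) (Z j))))))"

definition block_size :: "nat \<Rightarrow> (nat \<Rightarrow> nat) \<Rightarrow> nat \<Rightarrow> nat" where
  "block_size n z a = (\<Sum>i\<in>{1..n}. of_bool (z i = a))"

definition block_pairs :: "nat \<Rightarrow> (nat \<Rightarrow> nat) \<Rightarrow> nat \<Rightarrow> nat \<Rightarrow> nat" where
  "block_pairs n z a b = (\<Sum>i\<in>{1..n}. \<Sum>j\<in>{1..n} - {i}. of_bool (z i = a \<and> z j = b))"

definition block_edges ::
  "nat \<Rightarrow> (nat \<Rightarrow> nat \<Rightarrow> nat) \<Rightarrow> (nat \<Rightarrow> nat) \<Rightarrow> nat \<Rightarrow> nat \<Rightarrow> nat" where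
  "block_edges n A z a b =
     (\<Sum>i\<in>{1..n}. \<Sum>j\<in>{1..n} - {i}. of_bool (z i = a \<and> z j = b) * A i j)"

text \<open>
  The natural-number subtraction below does not truncate for a 0/1 matrix \<open>A\<close>, since then
  \<^term>\<open>block_edges n A z a b \<le> block_pairs n z a b\<close>.
\<close>

definition complete_lik ::
  "nat \<Rightarrow> nat \<Rightarrow> (nat \<Rightarrow> nat) \<Rightarrow> (nat \<Rightarrow> nat \<Rightarrow> nat) \<Rightarrow> sbm_param \<Rightarrow> real" where
  "complete_lik n K z A = (\<lambda>(\<pi>, H).
     (\<Prod>a\<in>{1..K}. \<pi> a ^ block_size n z a) *
     sqrt (\<Prod>a\<in>{1..K}. \<Prod>b\<in>{1..K}.
       H a b ^ block_edges n A z a b *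
       (1 - H a b) ^ (block_pairs n z a b - block_edges n A z a b)))"

definition marginal_lik :: "nat \<Rightarrow> nat \<Rightarrow> (nat \<Rightarrow> nat \<Rightarrow> nat) \<Rightarrow> sbm_param \<Rightarrow> real" where
  "marginal_lik n K A \<theta> = (\<Sum>z\<in>{1..n} \<rightarrow>\<^sub>E {1..K}. complete_lik n K z A \<theta>)"

definition log_lik_ratio :: "nat \<Rightarrow> nat \<Rightarrow> nat \<Rightarrow> (nat \<Rightarrow> nat \<Rightarrow> nat) \<Rightarrow> real" where
  "log_lik_ratio n K K' A =
     ln ((SUP \<theta>\<in>Theta K'. marginal_lik n K' A \<theta>) / (SUP \<theta>\<in>Theta K. marginal_lik n K A \<theta>))"

text \<open>\<open>X\<^sub>n = O\<^sub>P(r\<^sub>n)\<close>, where \<open>X\<^sub>n\<close> is a function of a sample from the \<open>n\<close>-th law \<open>p n\<close>.\<close>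

definition bigO_in_prob ::
  "(nat \<Rightarrow> 'a pmf) \<Rightarrow> (nat \<Rightarrow> 'a \<Rightarrow> real) \<Rightarrow> (nat \<Rightarrow> real) \<Rightarrow> bool" where
  "bigO_in_prob p X r \<longleftrightarrow>
     (\<forall>\<epsilon>>0. \<exists>C>0. \<forall>\<^sub>F n in sequentially.
        measure_pmf.prob (p n) {x. \<bar>X n x\<bar> > C * \<bar>r n\<bar>} < \<epsilon>)"

end

theory Submission
  imports Defs
begin

text \<open>
  Let \<open>A\<close> have law \<open>g(\<cdot>; \<theta>\<^sup>*)\<close>. If \<open>Q\<close> is a nonnegative function of graphs, then Markov's inequality
  for \<open>Q(A) / g(A; \<theta>\<^sup>*)\<close>, whose expectation is at most the total mass of \<open>Q\<close>, shows that
  \<open>Q(A) \<le> e\<^sup>t g(A; \<theta>\<^sup>*)\<close> except with probability at most that mass times \<open>exp (- t)\<close>. Applied to a \<open>Q\<close>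
  which dominates \<open>g(\<cdot>; \<theta>)\<close> for all \<open>\<theta> \<in> \<Theta>\<^sub>K\<^sub>'\<close> at once, and combined with
  \<open>g(A; \<theta>\<^sup>*) \<le> sup g(A; \<theta>)\<close> over \<open>\<Theta>\<^sub>K\<close>, this bounds the upper tail of the log likelihood ratio
  (\<open>prob_log_lik_ratio_gt\<close>).

  Such a \<open>Q\<close> of mass \<open>K'\<^sup>n\<close> times a polynomial in \<open>n\<close> exists. Given labels \<open>z\<close>, the edge likelihood
  is largest when \<open>H\<close> consists of the observed edge frequencies between the blocks. These are fractions
  \<open>k / m\<close> with \<open>k, m \<le> n\<^sup>2\<close>, so whatever the graph is, the maximiser lies in one set of at most
  \<open>(n\<^sup>2 + 1)\<close> to the power \<open>2 K'\<^sup>2\<close> matrices (\<open>ex_frequency_matrix_dominates\<close>). The sum of the edge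
  likelihoods over all labellings and all these matrices is the required envelope: each summand is a
  probability mass function of graphs, so the mass of \<open>Q\<close> is the number of summands
  (\<open>sum_envelope_le\<close>).

  For the lower tail, a parameter in \<open>\<Theta>\<^sub>K\<close> turns into one in \<open>\<Theta>\<^sub>K\<^sub>'\<close> by halving its weights and giving
  the other half to the new blocks. Labellings which avoid the new blocks alone then recover the
  likelihood up to a factor \<open>2\<^sup>n\<close> (\<open>embed_with_halved_weights\<close>), so the log likelihood ratio is
  always at least \<open>- n ln 2\<close>.

  Together these give a bound of order \<open>n\<close>. In either density regime \<open>n \<rho>\<^sub>n \<ge> 1\<close> eventually, and
  then \<open>n \<le> n (n \<rho>\<^sub>n) powr (1/2)\<close>, which is the rate of the theorem.
\<close>

section \<open>Graphs and their law given the labels\<close>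

text \<open>A graph is a Boolean function \<open>E\<close> on pairs \<open>i < j\<close> rather than a matrix: in this form the edges
  are independent coordinates of a product measure, and the graphs on \<open>n\<close> nodes form a finite set.\<close>

definition node_pairs :: "nat \<Rightarrow> (nat \<times> nat) set" where
  "node_pairs n = {(i, j). 1 \<le> i \<and> i < j \<and> j \<le> n}"

definition adjacency :: "(nat \<times> nat \<Rightarrow> bool) \<Rightarrow> nat \<Rightarrow> nat \<Rightarrow> nat" where
  "adjacency E = (\<lambda>i j. of_bool (E (min i j, max i j)))"

definition edge_pmf :: "nat \<Rightarrow> (nat \<Rightarrow> nat) \<Rightarrow> (nat \<Rightarrow> nat \<Rightarrow> real) \<Rightarrow> (nat \<times> nat \<Rightarrow> bool) pmf" where
  "edge_pmf n z H = Pi_pmf (node_pairs n) False (\<lambda>(i, j). bernoulli_pmf (H (z i) (z j)))"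

definition graphs :: "nat \<Rightarrow> (nat \<times> nat \<Rightarrow> bool) set" where
  "graphs n = PiE_dflt (node_pairs n) False (\<lambda>_. UNIV)"

text \<open>The closed interval is essential: observed edge frequencies may be \<open>0\<close> or \<open>1\<close>, and so may fall
  outside the open parameter space.\<close>

definition connectivity :: "nat \<Rightarrow> (nat \<Rightarrow> nat \<Rightarrow> real) \<Rightarrow> bool" where
  "connectivity K H \<longleftrightarrow>
     (\<forall>a\<in>{1..K}. \<forall>b\<in>{1..K}. 0 \<le> H a b \<and> H a b \<le> 1 \<and> H a b = H b a)"

lemma finite_node_pairs [simp]: "finite (node_pairs n)"
  by (rule finite_subset[of _ "{1..n} \<times> {1..n}"]) (auto simp: node_pairs_def)

lemma finite_graphs [simp]: "finite (graphs n)"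
  unfolding graphs_def by (intro finite_PiE_dflt) auto

lemma set_edge_pmf: "set_pmf (edge_pmf n z H) \<subseteq> graphs n"
  unfolding edge_pmf_def graphs_def
  using set_Pi_pmf_subset'[OF finite_node_pairs] by (fastforce simp: PiE_dflt_def)

lemma sum_pmf_edge_pmf: "(\<Sum>E\<in>graphs n. pmf (edge_pmf n z H) E) = 1"
  by (intro sum_pmf_eq_1 set_edge_pmf) simp

lemma connectivity_Theta: "(\<pi>, H) \<in> Theta K \<Longrightarrow> connectivity K H"
  by (fastforce simp: Theta_def connectivity_def)

lemma Theta_weight_sum:
  assumes "(\<pi>, H) \<in> Theta K" "1 \<le> K"
  shows "(\<Sum>a\<in>{1..K}. \<pi> a) = 1"
  using assms by (auto simp: Theta_def split: if_splits)

lemma Theta_weight_bounds: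
  assumes "(\<pi>, H) \<in> Theta K" "a \<in> {1..K}"
  shows "0 < \<pi> a" "\<pi> a \<le> 1"
proof -
  have pos: "0 < \<pi> b" if "b \<in> {1..K}" for b
    using assms(1) that by (auto simp: Theta_def split: if_splits)
  show "0 < \<pi> a" using pos assms(2) by blast
  have "\<pi> a \<le> (\<Sum>b\<in>{1..K}. \<pi> b)"
    using assms(2) pos by (intro member_le_sum) (auto intro: less_imp_le)
  also have "\<dots> = 1" using Theta_weight_sum assms by auto
  finally show "\<pi> a \<le> 1" .
qed

lemma pmf_edge_pmf:
  assumes "E \<in> graphs n"
  shows "pmf (edge_pmf n z H) E = (\<Prod>(i,j)\<in>node_pairs n. pmf (bernoulli_pmf (H (z i) (z j))) (E (i, j)))"
  unfolding edge_pmf_def using assms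
  by (subst pmf_Pi') (auto simp: graphs_def PiE_dflt_def intro!: prod.cong)

section \<open>The complete likelihood as a product over edges\<close>

text \<open>
  The block statistics count every unordered pair of nodes twice, once in each order. This is the
  reason for the square root in the likelihood.
\<close>

lemma prod_offdiagonal_eq_square:
  fixes h :: "nat \<Rightarrow> nat \<Rightarrow> real"
  assumes "\<And>i j. i \<in> {1..n} \<Longrightarrow> j \<in> {1..n} \<Longrightarrow> h i j = h j i"
  shows "(\<Prod>i\<in>{1..n}. \<Prod>j\<in>{1..n} - {i}. h i j) = (\<Prod>(i,j)\<in>node_pairs n. h i j)\<^sup>2"
proof -
  have D: "Sigma {1..n} (\<lambda>i. {1..n} - {i}) = node_pairs n \<union> prod.swap ` node_pairs n"
    by (auto simp: node_pairs_def image_iff)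
  have "(\<Prod>(i,j)\<in>prod.swap ` node_pairs n. h i j) = (\<Prod>(i,j)\<in>node_pairs n. h j i)"
    by (subst prod.reindex) (auto intro: inj_onI simp: case_prod_beta)
  also have "\<dots> = (\<Prod>(i,j)\<in>node_pairs n. h i j)"
    by (intro prod.cong) (auto simp: node_pairs_def intro!: assms)
  finally have sw: "(\<Prod>(i,j)\<in>prod.swap ` node_pairs n. h i j) = (\<Prod>(i,j)\<in>node_pairs n. h i j)" .
  have "(\<Prod>i\<in>{1..n}. \<Prod>j\<in>{1..n} - {i}. h i j) = (\<Prod>(i,j)\<in>Sigma {1..n} (\<lambda>i. {1..n} - {i}). h i j)"
    by (rule prod.Sigma) auto
  also have "\<dots> = (\<Prod>(i,j)\<in>node_pairs n. h i j) * (\<Prod>(i,j)\<in>prod.swap ` node_pairs n. h i j)"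
    unfolding D by (rule prod.union_disjoint) (simp, simp, auto simp: node_pairs_def)
  finally show ?thesis by (simp add: sw power2_eq_square)
qed

lemma adjacency_commute: "adjacency E i j = adjacency E j i"
  by (simp add: adjacency_def min.commute max.commute)

lemma block_pairs_minus_block_edges:
  "block_pairs n z a b - block_edges n (adjacency E) z a b =
     (\<Sum>i\<in>{1..n}. \<Sum>j\<in>{1..n} - {i}. of_bool (z i = a \<and> z j = b) * (1 - adjacency E i j))"
proof -
  have "block_pairs n z a b = block_edges n (adjacency E) z a b +
     (\<Sum>i\<in>{1..n}. \<Sum>j\<in>{1..n} - {i}. of_bool (z i = a \<and> z j = b) * (1 - adjacency E i j))"
    unfolding block_pairs_def block_edges_def sum.distrib[symmetric]
    by (intro sum.cong refl) (auto simp: adjacency_def)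
  thus ?thesis by simp
qed

lemma block_edges_le_block_pairs: "block_edges n (adjacency E) z a b \<le> block_pairs n z a b"
  unfolding block_edges_def block_pairs_def
  by (intro sum_mono) (auto simp: adjacency_def)

lemma block_pairs_le: "block_pairs n z a b \<le> n\<^sup>2"
proof -
  have "block_pairs n z a b \<le> (\<Sum>i\<in>{1..n}. \<Sum>j\<in>{1..n}. 1)"
    unfolding block_pairs_def by (intro sum_mono order.trans[OF sum_mono sum_mono2]) auto
  thus ?thesis by (simp add: power2_eq_square)
qed

lemma sum_offdiagonal_transpose:
  fixes f :: "nat \<Rightarrow> nat \<Rightarrow> nat"
  shows "(\<Sum>i\<in>{1..n}. \<Sum>j\<in>{1..n} - {i}. f i j) = (\<Sum>i\<in>{1..n}. \<Sum>j\<in>{1..n} - {i}. f j i)"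
proof -
  have *: "(\<Sum>i\<in>{1..n}. \<Sum>j\<in>{1..n} - {i}. g i j) = (\<Sum>i\<in>{1..n}. \<Sum>j\<in>{1..n}. if i = j then 0 else g i j)"
    for g :: "nat \<Rightarrow> nat \<Rightarrow> nat"
    by (intro sum.cong refl sum.mono_neutral_cong_left) auto
  show ?thesis
    unfolding * by (subst sum.swap) (intro sum.cong refl, auto)
qed

lemma block_pairs_commute: "block_pairs n z a b = block_pairs n z b a"
  unfolding block_pairs_def by (subst sum_offdiagonal_transpose) (simp add: conj_commute)

lemma block_edges_commute:
  "block_edges n (adjacency E) z a b = block_edges n (adjacency E) z b a"
  unfolding block_edges_def
  by (subst sum_offdiagonal_transpose) (simp add: conj_commute adjacency_commute)

text \<open>Each ordered pair of nodes contributes exactly one factor, \<open>H\<close> or \<open>1 - H\<close> at its labels, to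
  exactly one block; exchanging the products over blocks and over node pairs regroups these factors
  by pair. The identity lets facts about probability mass functions (total mass \<open>1\<close>) and about block
  counts (the maximising \<open>H\<close>) be used for the same quantity.\<close>

lemma sqrt_block_likelihood_eq_pmf:
  assumes z: "z \<in> {1..n} \<rightarrow> {1..K}" and E: "E \<in> graphs n" and H: "connectivity K H"
  shows "sqrt (\<Prod>a\<in>{1..K}. \<Prod>b\<in>{1..K}.
           H a b ^ block_edges n (adjacency E) z a b *
           (1 - H a b) ^ (block_pairs n z a b - block_edges n (adjacency E) z a b)) =
         pmf (edge_pmf n z H) E"
proof -
  \<comment> \<open>The factor contributed by the ordered pair of nodes \<open>(i, j)\<close>.\<close>
  define h where "h i j = (if adjacency E i j = 1 then H (z i) (z j) else 1 - H (z i) (z j))" for i j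
  define D where "D = Sigma {1..n} (\<lambda>i. {1..n} - {i})"
  have zK: "z i \<in> {1..K}" if "i \<in> {1..n}" for i using z that by auto
  have block: "H a b ^ block_edges n (adjacency E) z a b *
           (1 - H a b) ^ (block_pairs n z a b - block_edges n (adjacency E) z a b) =
        (\<Prod>(i,j)\<in>D. if z i = a \<and> z j = b then h i j else 1)" for a b
  proof -
    have "H a b ^ block_edges n (adjacency E) z a b *
           (1 - H a b) ^ (block_pairs n z a b - block_edges n (adjacency E) z a b) =
        (\<Prod>i\<in>{1..n}. \<Prod>j\<in>{1..n} - {i}. H a b ^ (of_bool (z i = a \<and> z j = b) * adjacency E i j) *
          (1 - H a b) ^ (of_bool (z i = a \<and> z j = b) * (1 - adjacency E i j)))"
      unfolding block_pairs_minus_block_edges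
      unfolding block_edges_def power_sum prod.distrib ..
    also have "\<dots> = (\<Prod>i\<in>{1..n}. \<Prod>j\<in>{1..n} - {i}. if z i = a \<and> z j = b then h i j else 1)"
      by (intro prod.cong refl) (auto simp: h_def adjacency_def)
    also have "\<dots> = (\<Prod>(i,j)\<in>D. if z i = a \<and> z j = b then h i j else 1)"
      unfolding D_def by (rule prod.Sigma) auto
    finally show ?thesis .
  qed
  have "(\<Prod>a\<in>{1..K}. \<Prod>b\<in>{1..K}. \<Prod>(i,j)\<in>D. if z i = a \<and> z j = b then h i j else 1) =
        (\<Prod>(i,j)\<in>D. \<Prod>a\<in>{1..K}. \<Prod>b\<in>{1..K}. if z i = a \<and> z j = b then h i j else 1)"
    by (subst prod.swap, subst prod.swap) (simp add: case_prod_beta)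
  also have "\<dots> = (\<Prod>(i,j)\<in>D. h i j)"
  proof (intro prod.cong refl, clarify)
    fix i j assume "(i, j) \<in> D"
    hence ij: "z i \<in> {1..K}" "z j \<in> {1..K}" using zK by (simp_all add: D_def)
    have "(\<Prod>a\<in>{1..K}. \<Prod>b\<in>{1..K}. if z i = a \<and> z j = b then h i j else 1) =
          (\<Prod>a\<in>{1..K}. if z i = a then (\<Prod>b\<in>{1..K}. if z j = b then h i j else 1) else 1)"
      by (intro prod.cong refl) auto
    also have "\<dots> = h i j" using ij by simp
    finally show "(\<Prod>a\<in>{1..K}. \<Prod>b\<in>{1..K}. if z i = a \<and> z j = b then h i j else 1) = h i j" .
  qed
  also have "\<dots> = (\<Prod>i\<in>{1..n}. \<Prod>j\<in>{1..n} - {i}. h i j)"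
    unfolding D_def by (rule prod.Sigma[symmetric]) auto
  also have "\<dots> = (\<Prod>(i,j)\<in>node_pairs n. h i j)\<^sup>2"
  proof (rule prod_offdiagonal_eq_square)
    fix i j assume "i \<in> {1..n}" "j \<in> {1..n}"
    hence "H (z i) (z j) = H (z j) (z i)" using H zK by (simp add: connectivity_def del: atLeastAtMost_iff)
    thus "h i j = h j i" by (simp add: h_def adjacency_commute)
  qed
  also have "(\<Prod>(i,j)\<in>node_pairs n. h i j) = pmf (edge_pmf n z H) E"
    unfolding pmf_edge_pmf[OF E]
  proof (intro prod.cong refl, clarify)
    fix i j assume ij: "(i, j) \<in> node_pairs n"
    hence "z i \<in> {1..K}" "z j \<in> {1..K}" using zK by (simp_all add: node_pairs_def)
    hence "0 \<le> H (z i) (z j)" "H (z i) (z j) \<le> 1" using H by (auto simp: connectivity_def)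
    moreover have "adjacency E i j = of_bool (E (i, j))"
      using ij by (simp add: adjacency_def node_pairs_def)
    ultimately show "h i j = pmf (bernoulli_pmf (H (z i) (z j))) (E (i, j))"
      by (cases "E (i, j)") (auto simp: h_def)
  qed
  finally show ?thesis by (simp add: block)
qed

lemma complete_lik_adjacency:
  assumes z: "z \<in> {1..n} \<rightarrow> {1..K}" and E: "E \<in> graphs n" and H: "connectivity K H"
  shows "complete_lik n K z (adjacency E) (\<pi>, H) =
           (\<Prod>i\<in>{1..n}. \<pi> (z i)) * pmf (edge_pmf n z H) E"
proof -
  have "(\<Prod>a\<in>{1..K}. \<pi> a ^ block_size n z a) =
        (\<Prod>a\<in>{1..K}. \<Prod>i\<in>{1..n}. if z i = a then \<pi> (z i) else 1)"
    unfolding block_size_def power_sum by (intro prod.cong refl) auto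
  also have "\<dots> = (\<Prod>i\<in>{1..n}. \<Prod>a\<in>{1..K}. if z i = a then \<pi> (z i) else 1)"
    by (rule prod.swap)
  also have "\<dots> = (\<Prod>i\<in>{1..n}. \<pi> (z i))"
    using z by (intro prod.cong refl) (auto simp: Pi_iff)
  finally show ?thesis
    unfolding complete_lik_def using sqrt_block_likelihood_eq_pmf[OF assms] by simp
qed

section \<open>An envelope for the likelihood of all parameters\<close>

text \<open>
  This is the inequality \<open>ln x \<le> x - 1\<close>, applied to \<open>h / p\<close> and \<open>(1 - h) / (1 - p)\<close> with \<open>p = k / m\<close>:
  the linear terms cancel, because \<open>p\<close> is the mean of the \<open>m\<close> observations. The boundary values of
  \<open>k\<close> and \<open>h\<close>, where a logarithm would be infinite, are treated separately.
\<close>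

lemma bernoulli_likelihood_le_max:
  fixes h :: real
  assumes h: "0 \<le> h" "h \<le> 1" and "k \<le> m"
  shows "h ^ k * (1 - h) ^ (m - k) \<le> (k / m) ^ k * (1 - k / m) ^ (m - k)"
proof -
  consider "k = 0" | "k = m" | "0 < k" "k < m" using \<open>k \<le> m\<close> by linarith
  thus ?thesis
  proof cases
    case 1 thus ?thesis using h by (simp add: power_le_one)
  next
    case 2 thus ?thesis using h by (cases "m = 0") (simp_all add: power_le_one)
  next
    case 3
    define p where "p = real k / real m"
    have p: "0 < p" "p < 1" using 3 by (auto simp: p_def)
    have mk: "real (m - k) = real m - real k" using 3 by simp
    have kp: "real k = real m * p" using 3 by (simp add: p_def)
    show ?thesis
    proof (cases "h = 0 \<or> h = 1")
      case True
      thus ?thesis using 3 p by (auto simp: p_def[symmetric] power_0_left)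
    next
      case False
      hence h': "0 < h" "h < 1" using h by auto
      have "real k * ln (h / p) + real (m - k) * ln ((1 - h) / (1 - p)) \<le>
            real k * (h / p - 1) + real (m - k) * ((1 - h) / (1 - p) - 1)"
        using h' p by (intro add_mono mult_left_mono ln_le_minus_one) auto
      also have "real k * (h / p - 1) = real m * (h - p)"
        using p by (simp add: kp field_simps)
      also have "real (m - k) * ((1 - h) / (1 - p) - 1) = real m * (p - h)"
        using p unfolding mk kp by (simp add: field_simps)
      also have "real m * (h - p) + real m * (p - h) = 0" by (simp add: algebra_simps)
      finally have "ln ((h / p) ^ k * ((1 - h) / (1 - p)) ^ (m - k)) \<le> 0"
        using h' p by (subst ln_mult) (auto simp: ln_realpow)
      hence "(h / p) ^ k * ((1 - h) / (1 - p)) ^ (m - k) \<le> 1"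
        using h' p by (subst (asm) ln_le_zero_iff) auto
      hence "h ^ k * (1 - h) ^ (m - k) / (p ^ k * (1 - p) ^ (m - k)) \<le> 1"
        by (simp add: power_divide)
      hence "h ^ k * (1 - h) ^ (m - k) \<le> p ^ k * (1 - p) ^ (m - k)"
        using p by (subst (asm) divide_le_eq_1_pos) auto
      thus ?thesis by (simp add: p_def)
    qed
  qed
qed

text \<open>This set contains every matrix of observed edge frequencies, for any graph and labelling on \<open>n\<close>
  nodes. A matrix is a function of an index pair here, so that the set is a \<^const>\<open>PiE\<close> and its
  cardinality a plain power. Blocks without node pairs give the entry \<open>0 / 0 = 0\<close>.\<close>

definition frequency_matrices :: "nat \<Rightarrow> nat \<Rightarrow> (nat \<times> nat \<Rightarrow> real) set" where
  "frequency_matrices n K = ({1..K} \<times> {1..K}) \<rightarrow>\<^sub>E ((\<lambda>(k, m). real k / real m) ` ({..n\<^sup>2} \<times> {..n\<^sup>2}))"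

lemma finite_frequency_matrices [simp]: "finite (frequency_matrices n K)"
  unfolding frequency_matrices_def by (intro finite_PiE) auto

lemma card_frequency_matrices: "card (frequency_matrices n K) \<le> (n\<^sup>2 + 1) ^ (2 * K\<^sup>2)"
proof -
  have "card (frequency_matrices n K) =
          card ((\<lambda>(k, m). real k / real m) ` ({..n\<^sup>2} \<times> {..n\<^sup>2})) ^ (K\<^sup>2)"
    unfolding frequency_matrices_def by (simp add: card_PiE power2_eq_square)
  also have "\<dots> \<le> ((n\<^sup>2 + 1)\<^sup>2) ^ (K\<^sup>2)"
    by (intro power_mono order.trans[OF card_image_le]) (auto simp: power2_eq_square)
  also have "\<dots> = (n\<^sup>2 + 1) ^ (2 * K\<^sup>2)" by (rule power_mult[symmetric])
  finally show ?thesis .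
qed

text \<open>The dominating matrix has the entries \<open>O\<^sub>a\<^sub>b / n\<^sub>a\<^sub>b\<close>, which maximise the likelihood of each block
  separately. They depend on \<open>E\<close> and \<open>z\<close>, but the set they are chosen from does not, and this permits
  summing the likelihoods over that set.\<close>

lemma ex_frequency_matrix_dominates:
  assumes z: "z \<in> {1..n} \<rightarrow> {1..K}" and E: "E \<in> graphs n" and H: "connectivity K H"
  shows "\<exists>G\<in>frequency_matrices n K. pmf (edge_pmf n z H) E \<le> pmf (edge_pmf n z (curry G)) E"
proof -
  define e where "e = block_edges n (adjacency E) z"
  define m where "m = block_pairs n z"
  define G where "G = (\<lambda>(a, b)\<in>{1..K} \<times> {1..K}. real (e a b) / real (m a b))"
  have G: "curry G a b = real (e a b) / real (m a b)" if "a \<in> {1..K}" "b \<in> {1..K}" for a b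
    using that by (simp add: G_def)
  have em: "e a b \<le> m a b" for a b
    unfolding e_def m_def by (rule block_edges_le_block_pairs)
  have "G \<in> frequency_matrices n K"
    unfolding frequency_matrices_def
  proof (rule PiE_I)
    fix x assume "x \<in> {1..K} \<times> {1..K}"
    moreover have "e a b \<le> n\<^sup>2" "m a b \<le> n\<^sup>2" for a b
      using em[of a b] block_pairs_le[of n z a b] by (auto simp: m_def)
    ultimately show "G x \<in> (\<lambda>(k, m). real k / real m) ` ({..n\<^sup>2} \<times> {..n\<^sup>2})"
      by (force simp: G_def)
  qed (simp add: G_def)
  moreover have "connectivity K (curry G)"
    unfolding connectivity_def
  proof (intro ballI)
    fix a b assume ab: "a \<in> {1..K}" "b \<in> {1..K}"
    show "0 \<le> curry G a b \<and> curry G a b \<le> 1 \<and> curry G a b = curry G b a"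
      unfolding G[OF ab] G[OF ab(2,1)] using em[of a b]
      by (auto simp: divide_le_eq e_def m_def block_pairs_commute[of n z a b]
            block_edges_commute[of n E z a b])
  qed
  moreover have "pmf (edge_pmf n z H) E \<le> pmf (edge_pmf n z (curry G)) E"
    unfolding sqrt_block_likelihood_eq_pmf[OF z E H, symmetric]
      sqrt_block_likelihood_eq_pmf[OF z E \<open>connectivity K (curry G)\<close>, symmetric]
  proof (intro real_sqrt_le_mono prod_mono conjI prod_nonneg)
    fix a b assume ab: "a \<in> {1..K}" "b \<in> {1..K}"
    have h: "0 \<le> H a b" "H a b \<le> 1" using H ab by (auto simp: connectivity_def)
    show "H a b ^ block_edges n (adjacency E) z a b *
        (1 - H a b) ^ (block_pairs n z a b - block_edges n (adjacency E) z a b) \<le>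
        curry G a b ^ block_edges n (adjacency E) z a b *
        (1 - curry G a b) ^ (block_pairs n z a b - block_edges n (adjacency E) z a b)"
      unfolding G[OF ab] unfolding e_def m_def
      by (rule bernoulli_likelihood_le_max[OF h block_edges_le_block_pairs])
  qed (use H in \<open>auto simp: connectivity_def\<close>)
  ultimately show ?thesis by blast
qed

definition lik_envelope :: "nat \<Rightarrow> nat \<Rightarrow> (nat \<times> nat \<Rightarrow> bool) \<Rightarrow> real" where
  "lik_envelope n K E =
     (\<Sum>z\<in>{1..n} \<rightarrow>\<^sub>E {1..K}. \<Sum>G\<in>frequency_matrices n K. pmf (edge_pmf n z (curry G)) E)"

text \<open>The label weights are simply bounded by \<open>1\<close>. This is what costs the factor \<open>K\<^sup>n\<close> in the mass of the
  envelope, which is harmless for a bound of order \<open>n\<close> on the logarithm.\<close>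

lemma marginal_lik_le_envelope:
  assumes E: "E \<in> graphs n" and \<theta>: "\<theta> \<in> Theta K"
  shows "marginal_lik n K (adjacency E) \<theta> \<le> lik_envelope n K E"
  unfolding marginal_lik_def lik_envelope_def
proof (rule sum_mono)
  fix z assume "z \<in> {1..n} \<rightarrow>\<^sub>E {1..K}"
  hence z: "z \<in> {1..n} \<rightarrow> {1..K}" by auto
  obtain \<pi> H where [simp]: "\<theta> = (\<pi>, H)" by fastforce
  have H: "connectivity K H" using \<theta> by (simp add: connectivity_Theta)
  obtain G where G: "G \<in> frequency_matrices n K" "pmf (edge_pmf n z H) E \<le> pmf (edge_pmf n z (curry G)) E"
    using ex_frequency_matrix_dominates[OF z E H] by blast
  have "(\<Prod>i\<in>{1..n}. \<pi> (z i)) \<le> 1"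
    using z \<theta> by (intro prod_le_1) (auto simp del: atLeastAtMost_iff dest!: funcset_mem dest: Theta_weight_bounds intro: less_imp_le)
  hence "complete_lik n K z (adjacency E) \<theta> \<le> pmf (edge_pmf n z H) E"
    using mult_right_mono[OF _ pmf_nonneg[of "edge_pmf n z H" E]] complete_lik_adjacency[OF z E H, of \<pi>]
    by fastforce
  also note G(2)
  also have "pmf (edge_pmf n z (curry G)) E \<le> (\<Sum>G\<in>frequency_matrices n K. pmf (edge_pmf n z (curry G)) E)"
    using G(1) by (intro member_le_sum) auto
  finally show "complete_lik n K z (adjacency E) \<theta> \<le> (\<Sum>G\<in>frequency_matrices n K. pmf (edge_pmf n z (curry G)) E)" .
qed

lemma sum_envelope_le:
  "(\<Sum>E\<in>graphs n. lik_envelope n K E) \<le> real K ^ n * real (n\<^sup>2 + 1) ^ (2 * K\<^sup>2)"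
proof -
  have "(\<Sum>E\<in>graphs n. lik_envelope n K E) =
     (\<Sum>z\<in>{1..n} \<rightarrow>\<^sub>E {1..K}. \<Sum>G\<in>frequency_matrices n K. \<Sum>E\<in>graphs n. pmf (edge_pmf n z (curry G)) E)"
    unfolding lik_envelope_def by (subst sum.swap, subst sum.swap) (rule refl)
  also have "\<dots> = real K ^ n * real (card (frequency_matrices n K))"
    by (simp add: sum_pmf_edge_pmf card_PiE)
  also have "\<dots> \<le> real K ^ n * real ((n\<^sup>2 + 1) ^ (2 * K\<^sup>2))"
    by (intro mult_left_mono of_nat_mono card_frequency_matrices) auto
  finally show ?thesis by simp
qed

section \<open>The law of the graph as a marginal likelihood\<close>

text \<open>
  The labels outside the node set default to \<^const>\<open>undefined\<close>, so that the labellings charged are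
  those over which \<^const>\<open>marginal_lik\<close> sums; the law of the graph does not see this default.
\<close>

definition graph_pmf :: "nat \<Rightarrow> nat \<Rightarrow> sbm_param \<Rightarrow> (nat \<times> nat \<Rightarrow> bool) pmf" where
  "graph_pmf n K = (\<lambda>(\<pi>, H).
     bind_pmf (Pi_pmf {1..n} undefined (\<lambda>_. label_pmf K \<pi>)) (\<lambda>z. edge_pmf n z H))"

lemma sbm_pmf_eq_map_graph_pmf: "sbm_pmf n K \<theta> = map_pmf adjacency (graph_pmf n K \<theta>)"
proof -
  obtain \<pi> H where \<theta>: "\<theta> = (\<pi>, H)" by fastforce
  have "Pi_pmf {(i, j). 1 \<le> i \<and> i < j \<and> j \<le> n} False (\<lambda>(i, j). bernoulli_pmf (H (Z i) (Z j))) =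
        edge_pmf n Z H" for Z
    unfolding edge_pmf_def node_pairs_def ..
  moreover have "edge_pmf n (\<lambda>x. if x \<in> {1..n} then z x else 0) H = edge_pmf n z H" for z
    unfolding edge_pmf_def by (intro Pi_pmf_cong) (auto simp: node_pairs_def)
  ultimately show ?thesis
    unfolding \<theta> sbm_pmf_def graph_pmf_def prod.case
    by (subst Pi_pmf_default_swap[of "{1..n}" 0 undefined, symmetric])
       (simp_all add: map_bind_pmf bind_map_pmf adjacency_def[abs_def])
qed

lemma set_graph_pmf: "set_pmf (graph_pmf n K \<theta>) \<subseteq> graphs n"
  using set_edge_pmf by (auto simp: graph_pmf_def split: prod.splits)

lemma pmf_graph_pmf:
  assumes \<theta>: "\<theta> \<in> Theta K" and K: "1 \<le> K" and E: "E \<in> graphs n"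
  shows "pmf (graph_pmf n K \<theta>) E = marginal_lik n K (adjacency E) \<theta>"
proof -
  obtain \<pi> H where [simp]: "\<theta> = (\<pi>, H)" by fastforce
  let ?P = "Pi_pmf {1..n} undefined (\<lambda>_. label_pmf K \<pi>)"
  have l: "pmf (label_pmf K \<pi>) a = (if a \<in> {1..K} then \<pi> a else 0)" for a
    using pmf_label_pmf \<theta> K by simp
  hence "set_pmf (label_pmf K \<pi>) \<subseteq> {1..K}" by (auto simp: set_pmf_eq split: if_splits)
  hence P: "set_pmf ?P \<subseteq> {1..n} \<rightarrow>\<^sub>E {1..K}"
    using set_Pi_pmf_subset'[of "{1..n}" undefined "\<lambda>_. label_pmf K \<pi>"]
    unfolding PiE_dflt_def PiE_iff extensional_def o_def by blast
  have "pmf (graph_pmf n K \<theta>) E = (\<Sum>z\<in>{1..n} \<rightarrow>\<^sub>E {1..K}. pmf ?P z * pmf (edge_pmf n z H) E)"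
    unfolding graph_pmf_def \<open>\<theta> = (\<pi>, H)\<close> prod.case pmf_bind mult.commute[of "pmf ?P _"]
    using P by (intro integral_measure_pmf_real finite_PiE) blast+
  also have "\<dots> = marginal_lik n K (adjacency E) \<theta>"
    unfolding marginal_lik_def
  proof (rule sum.cong[OF refl])
    fix z assume z: "z \<in> {1..n} \<rightarrow>\<^sub>E {1..K}"
    have "pmf ?P z = (\<Prod>i\<in>{1..n}. \<pi> (z i))"
      using z by (subst pmf_Pi') (auto simp: l PiE_iff extensional_def intro!: prod.cong)
    thus "pmf ?P z * pmf (edge_pmf n z H) E = complete_lik n K z (adjacency E) \<theta>"
      using complete_lik_adjacency[of z n K E H \<pi>] z E connectivity_Theta \<theta> by (auto simp: PiE_iff Pi_iff)
  qed
  finally show ?thesis .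
qed


section \<open>The lower tail: embedding the smaller model\<close>

lemma bdd_above_marginal_lik:
  "E \<in> graphs n \<Longrightarrow> bdd_above (marginal_lik n K (adjacency E) ` Theta K)"
  by (intro bdd_aboveI2[where M = "lik_envelope n K E"] marginal_lik_le_envelope)

lemma marginal_lik_pos:
  assumes "\<theta> \<in> Theta K" "1 \<le> K"
  shows "0 < marginal_lik n K A \<theta>"
  unfolding marginal_lik_def
proof (rule sum_pos)
  obtain \<pi> H where \<theta>: "\<theta> = (\<pi>, H)" by fastforce
  fix z
  have "0 < \<pi> a" if "a \<in> {1..K}" for a
    using Theta_weight_bounds assms that unfolding \<theta> by blast
  moreover have "0 < H a b" "H a b < 1" if "a \<in> {1..K}" "b \<in> {1..K}" for a b
    using assms that by (auto simp: \<theta> Theta_def)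
  ultimately show "0 < complete_lik n K z A \<theta>"
    unfolding \<theta> complete_lik_def prod.case
    by (intro mult_pos_pos prod_pos zero_less_power ballI iffD2[OF real_sqrt_gt_0_iff]) auto
qed (use assms in \<open>auto simp: finite_PiE PiE_eq_empty_iff\<close>)

text \<open>Labellings by the old blocks keep their edge likelihood, and halving the weights multiplies their
  label likelihood by \<open>1 / 2\<^sup>n\<close>. The remaining labellings only add nonnegative terms. The value
  \<open>1 / 2\<close> for the new entries of \<open>H\<close> is an arbitrary point of \<open>(0, 1)\<close>.\<close>

lemma embed_with_halved_weights:
  assumes \<theta>: "\<theta> \<in> Theta K" and K: "1 \<le> K" "K < K'"
  obtains \<theta>' where "\<theta>' \<in> Theta K'"
    "\<And>E. E \<in> graphs n \<Longrightarrow>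
       marginal_lik n K (adjacency E) \<theta> \<le> 2 ^ n * marginal_lik n K' (adjacency E) \<theta>'"
proof -
  obtain \<pi> H where [simp]: "\<theta> = (\<pi>, H)" by fastforce
  define \<pi>' where "\<pi>' a = (if a \<le> K then \<pi> a / 2 else 1 / (2 * real (K' - K)))" for a
  define H' where "H' a b = (if a \<le> K \<and> b \<le> K then H a b else 1 / 2)" for a b
  have split: "{1..K'} = {1..K} \<union> {K+1..K'}" using K by auto
  have "(\<Sum>a\<in>{1..K'}. \<pi>' a) = (\<Sum>a\<in>{1..K}. \<pi>' a) + (\<Sum>a\<in>{K+1..K'}. \<pi>' a)"
    unfolding split by (rule sum.union_disjoint) auto
  also have "(\<Sum>a\<in>{1..K}. \<pi>' a) = (\<Sum>a\<in>{1..K}. \<pi> a) / 2"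
    unfolding sum_divide_distrib by (intro sum.cong) (auto simp: \<pi>'_def)
  also have "\<dots> = 1 / 2" using Theta_weight_sum[of \<pi> H K] \<theta> K by simp
  also have "(\<Sum>a\<in>{K+1..K'}. \<pi>' a) = (\<Sum>a\<in>{K+1..K'}. 1 / (2 * real (K' - K)))"
    by (intro sum.cong) (auto simp: \<pi>'_def)
  also have "\<dots> = 1 / 2" using K by simp
  finally have sum: "(\<Sum>a\<in>{1..K'}. \<pi>' a) = 1" by simp
  have "0 < \<pi>' a \<and> \<pi>' a < 1" if "a \<in> {1..K'}" for a
  proof (cases "a \<le> K")
    case True
    thus ?thesis using Theta_weight_bounds[of \<pi> H K a] \<theta> that by (simp add: \<pi>'_def)
  next
    case False
    have "1 \<le> real (K' - K)" using K by linarith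
    hence "0 < 1 / (2 * real (K' - K)) \<and> 1 / (2 * real (K' - K)) < 1" by (simp add: divide_less_eq)
    thus ?thesis using False by (simp add: \<pi>'_def)
  qed
  moreover have "H' a b \<in> {0<..<1} \<and> H' a b = H' b a" if "a \<in> {1..K'}" "b \<in> {1..K'}" for a b
    using \<theta> that by (auto simp: H'_def Theta_def)
  ultimately have \<theta>': "(\<pi>', H') \<in> Theta K'" using sum K by (simp add: Theta_def)
  moreover have "marginal_lik n K (adjacency E) \<theta> \<le> 2 ^ n * marginal_lik n K' (adjacency E) (\<pi>', H')"
    if E: "E \<in> graphs n" for E
  proof -
    have "complete_lik n K z (adjacency E) \<theta> = 2 ^ n * complete_lik n K' z (adjacency E) (\<pi>', H')"
      if "z \<in> {1..n} \<rightarrow>\<^sub>E {1..K}" for z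
    proof -
      from that have z: "z \<in> {1..n} \<rightarrow> {1..K}" by auto
      hence z': "z \<in> {1..n} \<rightarrow> {1..K'}" using K by (fastforce simp: Pi_iff)
      have "edge_pmf n z H = edge_pmf n z H'"
        unfolding edge_pmf_def using z
        by (intro Pi_pmf_cong) (auto simp: H'_def node_pairs_def Pi_iff)
      moreover have "(\<Prod>i\<in>{1..n}. \<pi> (z i)) = 2 ^ n * (\<Prod>i\<in>{1..n}. \<pi>' (z i))"
      proof -
        have "(\<Prod>i\<in>{1..n}. \<pi> (z i)) = (\<Prod>i\<in>{1..n}. 2 * \<pi>' (z i))"
          using z by (intro prod.cong) (auto simp: \<pi>'_def Pi_iff)
        thus ?thesis by (simp add: prod.distrib)
      qed
      ultimately show ?thesis
        using complete_lik_adjacency[OF z E, of H \<pi>] complete_lik_adjacency[OF z' E, of H' \<pi>']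
          connectivity_Theta \<theta> \<theta>' by simp
    qed
    hence "marginal_lik n K (adjacency E) \<theta> =
        2 ^ n * (\<Sum>z\<in>{1..n} \<rightarrow>\<^sub>E {1..K}. complete_lik n K' z (adjacency E) (\<pi>', H'))"
      unfolding marginal_lik_def sum_distrib_left by (intro sum.cong) auto
    also have "\<dots> \<le> 2 ^ n * marginal_lik n K' (adjacency E) (\<pi>', H')"
      unfolding marginal_lik_def
    proof (intro mult_left_mono sum_mono2)
      show "finite ({1..n} \<rightarrow>\<^sub>E {1..K'})" by (intro finite_PiE) auto
      show "({1..n} \<rightarrow>\<^sub>E {1..K}) \<subseteq> {1..n} \<rightarrow>\<^sub>E {1..K'}" using K by (intro PiE_mono) auto
      fix z assume "z \<in> ({1..n} \<rightarrow>\<^sub>E {1..K'}) - ({1..n} \<rightarrow>\<^sub>E {1..K})"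
      hence z: "z \<in> {1..n} \<rightarrow> {1..K'}" by auto
      have "0 \<le> (\<Prod>i\<in>{1..n}. \<pi>' (z i))"
        using z Theta_weight_bounds(1)[OF \<theta>'] by (intro prod_nonneg) (auto simp: Pi_iff less_imp_le)
      thus "0 \<le> complete_lik n K' z (adjacency E) (\<pi>', H')"
        unfolding complete_lik_adjacency[OF z E connectivity_Theta[OF \<theta>']] by simp
    qed auto
    finally show ?thesis .
  qed
  ultimately show ?thesis using that by blast
qed

lemma log_lik_ratio_ge:
  assumes \<theta>: "\<theta> \<in> Theta K" and K: "1 \<le> K" "K < K'" and E: "E \<in> graphs n"
  shows "- (real n * ln 2) \<le> log_lik_ratio n K K' (adjacency E)"
proof -
  let ?A = "adjacency E"
  define M where "M = (SUP \<theta>\<in>Theta K. marginal_lik n K ?A \<theta>)"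
  define M' where "M' = (SUP \<theta>\<in>Theta K'. marginal_lik n K' ?A \<theta>)"
  have "M \<le> 2 ^ n * M'"
    unfolding M_def
  proof (rule cSUP_least)
    fix \<eta> assume \<eta>: "\<eta> \<in> Theta K"
    obtain \<eta>' where \<eta>': "\<eta>' \<in> Theta K'" "marginal_lik n K ?A \<eta> \<le> 2 ^ n * marginal_lik n K' ?A \<eta>'"
      using embed_with_halved_weights[OF \<eta> K, of n] E by metis
    have "marginal_lik n K' ?A \<eta>' \<le> M'"
      unfolding M'_def by (intro cSUP_upper \<eta>' bdd_above_marginal_lik E)
    thus "marginal_lik n K ?A \<eta> \<le> 2 ^ n * M'"
      by (intro order.trans[OF \<eta>'(2)]) simp
  qed (use \<theta> in auto)
  moreover have M: "0 < M"
    unfolding M_def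
    by (rule less_le_trans[OF marginal_lik_pos[OF \<theta> K(1)] cSUP_upper[OF \<theta> bdd_above_marginal_lik[OF E]]])
  ultimately have "1 / 2 ^ n \<le> M' / M" by (simp add: field_simps)
  hence "ln (1 / 2 ^ n) \<le> ln (M' / M)" by (intro ln_mono) auto
  thus ?thesis by (simp add: log_lik_ratio_def M_def M'_def ln_div ln_realpow)
qed

section \<open>The upper tail: a change of measure\<close>

text \<open>
  The likelihood at the true parameter is at most the supremum over the smaller model, and the
  envelope is at least the supremum over the larger one. So a large ratio of the suprema forces the
  true law to be small relative to the envelope.
\<close>

lemma pmf_le_envelope_of_large_ratio:
  assumes \<theta>: "\<theta> \<in> Theta K" and K: "1 \<le> K" "K < K'" and E: "E \<in> graphs n"
    and t: "t < log_lik_ratio n K K' (adjacency E)"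
  shows "pmf (graph_pmf n K \<theta>) E \<le> exp (- t) * lik_envelope n K' E"
proof -
  let ?A = "adjacency E"
  define M where "M = (SUP \<theta>\<in>Theta K. marginal_lik n K ?A \<theta>)"
  define M' where "M' = (SUP \<theta>\<in>Theta K'. marginal_lik n K' ?A \<theta>)"
  \<comment> \<open>A point of the larger parameter space makes its supremum positive, so that the logarithm of the
    ratio can be inverted.\<close>
  obtain \<theta>' where \<theta>': "\<theta>' \<in> Theta K'" using embed_with_halved_weights[OF \<theta> K] by blast
  have M: "marginal_lik n K ?A \<theta> \<le> M"
    unfolding M_def by (rule cSUP_upper[OF \<theta> bdd_above_marginal_lik[OF E]])
  hence pos: "0 < M" using marginal_lik_pos[OF \<theta> K(1)] by (rule less_le_trans[rotated])
  have "marginal_lik n K' ?A \<theta>' \<le> M'"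
    unfolding M'_def by (rule cSUP_upper[OF \<theta>' bdd_above_marginal_lik[OF E]])
  hence pos': "0 < M'" using marginal_lik_pos[OF \<theta>', of n ?A] K by linarith
  have "exp t \<le> exp (ln (M' / M))"
    using t by (simp add: log_lik_ratio_def M_def M'_def)
  hence "exp t * M \<le> M'" using pos pos' by (simp add: field_simps)
  also have "M' \<le> lik_envelope n K' E"
    unfolding M'_def using \<theta>' by (intro cSUP_least marginal_lik_le_envelope E) auto
  finally have "M \<le> exp (- t) * lik_envelope n K' E"
    by (simp add: exp_minus field_simps)
  with M show ?thesis by (simp add: pmf_graph_pmf[OF \<theta> K(1) E])
qed

lemma prob_log_lik_ratio_gt:
  assumes \<theta>: "\<theta> \<in> Theta K" and K: "1 \<le> K" "K < K'"
  shows "measure_pmf.prob (graph_pmf n K \<theta>) {E. t < log_lik_ratio n K K' (adjacency E)}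
           \<le> exp (- t) * (real K' ^ n * real (n\<^sup>2 + 1) ^ (2 * K'\<^sup>2))"
proof -
  define B where "B = {E. t < log_lik_ratio n K K' (adjacency E)}"
  have env: "0 \<le> lik_envelope n K' E" for E
    unfolding lik_envelope_def by (intro sum_nonneg pmf_nonneg)
  have "measure_pmf.prob (graph_pmf n K \<theta>) B \<le> measure_pmf.prob (graph_pmf n K \<theta>) (B \<inter> graphs n)"
    unfolding measure_Int_set_pmf[symmetric, of _ B]
    using set_graph_pmf[of n K \<theta>] by (intro measure_pmf.finite_measure_mono) auto
  also have "\<dots> = (\<Sum>E\<in>B \<inter> graphs n. pmf (graph_pmf n K \<theta>) E)"
    by (rule measure_measure_pmf_finite) simp
  also have "\<dots> \<le> (\<Sum>E\<in>B \<inter> graphs n. exp (- t) * lik_envelope n K' E)"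
    using pmf_le_envelope_of_large_ratio[OF \<theta> K] by (intro sum_mono) (auto simp: B_def)
  also have "\<dots> \<le> (\<Sum>E\<in>graphs n. exp (- t) * lik_envelope n K' E)"
    using env by (intro sum_mono2) auto
  also have "\<dots> \<le> exp (- t) * (real K' ^ n * real (n\<^sup>2 + 1) ^ (2 * K'\<^sup>2))"
    unfolding sum_distrib_left[symmetric] by (intro mult_left_mono sum_envelope_le) auto
  finally show ?thesis by (simp add: B_def)
qed

text \<open>The constant \<open>ln K' + 1\<close> pays for the \<open>K'\<^sup>n\<close> labellings and leaves a factor \<open>exp (- n)\<close> that beats
  the number of frequency matrices. Since it is at least \<open>ln 2\<close>, a deviation of this size cannot be
  negative, and only the upper tail contributes.\<close>

lemma prob_abs_log_lik_ratio_gt: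
  assumes \<theta>: "\<theta> \<in> Theta K" and K: "1 \<le> K" "K < K'" and r: "real n \<le> r"
  shows "measure_pmf.prob (sbm_pmf n K \<theta>) {A. (ln (real K') + 1) * r < \<bar>log_lik_ratio n K K' A\<bar>}
           \<le> real (n\<^sup>2 + 1) ^ (2 * K'\<^sup>2) / exp (real n)"
proof -
  let ?p = "graph_pmf n K \<theta>"
  define C where "C = ln (real K') + 1"
  have C: "ln 2 \<le> C" using K by (auto simp: C_def intro!: order.trans[OF ln_mono[of 2 "real K'"]])
  have "measure_pmf.prob (sbm_pmf n K \<theta>) {A. C * r < \<bar>log_lik_ratio n K K' A\<bar>} =
      measure_pmf.prob ?p ({E. C * r < \<bar>log_lik_ratio n K K' (adjacency E)\<bar>} \<inter> set_pmf ?p)"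
    by (simp add: sbm_pmf_eq_map_graph_pmf measure_Int_set_pmf vimage_def)
  also have "\<dots> \<le> measure_pmf.prob ?p {E. C * real n < log_lik_ratio n K K' (adjacency E)}"
  proof (intro measure_pmf.finite_measure_mono)
    have "C * real n < log_lik_ratio n K K' (adjacency E)"
      if "C * r < \<bar>log_lik_ratio n K K' (adjacency E)\<bar>" "E \<in> graphs n" for E
    proof -
      have "C * real n \<le> C * r" using r order.trans[OF ln_ge_zero C] by (intro mult_left_mono) auto
      moreover have "real n * ln 2 \<le> real n * C" using C by (intro mult_left_mono) auto
      ultimately show ?thesis
        using that(1) log_lik_ratio_ge[OF \<theta> K that(2)] by (auto simp: mult.commute abs_if split: if_splits)
    qed
    thus "{E. C * r < \<bar>log_lik_ratio n K K' (adjacency E)\<bar>} \<inter> set_pmf ?p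
        \<subseteq> {E. C * real n < log_lik_ratio n K K' (adjacency E)}"
      using set_graph_pmf by blast
  qed auto
  also have "\<dots> \<le> exp (- (C * real n)) * (real K' ^ n * real (n\<^sup>2 + 1) ^ (2 * K'\<^sup>2))"
    by (rule prob_log_lik_ratio_gt[OF \<theta> K])
  also have "exp (- (C * real n)) = 1 / (real K' ^ n * exp (real n))"
  proof -
    have "exp (C * real n) = exp (real n * ln (real K')) * exp (real n)"
      by (simp add: C_def algebra_simps flip: exp_add)
    also have "\<dots> = real K' ^ n * exp (real n)"
      using K by (simp add: exp_of_nat_mult)
    finally show ?thesis by (simp add: exp_minus field_simps)
  qed
  also have "1 / (real K' ^ n * exp (real n)) * (real K' ^ n * real (n\<^sup>2 + 1) ^ (2 * K'\<^sup>2)) =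
      real (n\<^sup>2 + 1) ^ (2 * K'\<^sup>2) / exp (real n)"
    using K by simp
  finally show ?thesis by (simp add: C_def)
qed

section \<open>Comparison with the rate\<close>

lemma polynomial_over_exp_tendsto_0:
  "(\<lambda>n. real (n\<^sup>2 + 1) ^ d / exp (real n)) \<longlonglongrightarrow> 0"
proof (rule tendsto_sandwich[of "\<lambda>_. 0"])
  show "\<forall>\<^sub>F n in sequentially. real (n\<^sup>2 + 1) ^ d / exp (real n) \<le> 2 ^ d * (real n ^ (2 * d) / exp (real n))"
  proof (rule eventually_sequentiallyI[of 1])
    fix n :: nat assume "1 \<le> n"
    hence "real (n\<^sup>2 + 1) \<le> 2 * real n ^ 2" by simp
    hence "real (n\<^sup>2 + 1) ^ d \<le> (2 * real n ^ 2) ^ d" by (intro power_mono) auto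
    also have "\<dots> = 2 ^ d * real n ^ (2 * d)" by (simp add: power_mult_distrib power_mult)
    finally show "real (n\<^sup>2 + 1) ^ d / exp (real n) \<le> 2 ^ d * (real n ^ (2 * d) / exp (real n))"
      by (simp add: divide_right_mono)
  qed
  show "(\<lambda>n. 2 ^ d * (real n ^ (2 * d) / exp (real n))) \<longlonglongrightarrow> 0"
    by (intro tendsto_mult_right_zero
        filterlim_compose[OF tendsto_power_div_exp_0 filterlim_real_sequentially])
qed auto

text \<open>Writing the rate as \<open>n (n \<rho>\<^sub>n) powr (1/2)\<close> reduces the claim to \<open>n \<rho>\<^sub>n \<ge> 1\<close>, that is, to an average
  degree bounded below.\<close>

lemma eventually_linear_le_rate:
  fixes \<rho> :: "nat \<Rightarrow> real"
  assumes pos: "\<And>n. 1 \<le> n \<Longrightarrow> 0 < \<rho> n"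
    and density: "\<rho> \<in> \<Omega>(\<lambda>_. 1) \<or>
                  (\<rho> \<longlonglongrightarrow> 0 \<and>
                   filterlim (\<lambda>n. real n * \<rho> n / ln (real n)) at_top sequentially)"
  shows "\<forall>\<^sub>F n in sequentially. real n \<le> real n powr (3/2) * \<rho> n powr (1/2)"
proof -
  have "\<forall>\<^sub>F n in sequentially. 1 \<le> real n * \<rho> n"
    using density
  proof
    assume "\<rho> \<in> \<Omega>(\<lambda>_. 1)"
    then obtain c where c: "0 < c" "\<forall>\<^sub>F n in sequentially. c * norm (1::real) \<le> norm (\<rho> n)"
      by (rule landau_omega.bigE)
    have "\<forall>\<^sub>F n in sequentially. 1 / c \<le> real n"
      using filterlim_real_sequentially by (simp add: filterlim_at_top)
    with c(2) eventually_ge_at_top[of 1] show ?thesis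
    proof eventually_elim
      case (elim n)
      hence "c \<le> \<rho> n" using pos[of n] by simp
      hence "1 / c * c \<le> real n * \<rho> n" using elim c(1) by (intro mult_mono) auto
      thus ?case using c(1) by simp
    qed
  next
    assume "\<rho> \<longlonglongrightarrow> 0 \<and> filterlim (\<lambda>n. real n * \<rho> n / ln (real n)) at_top sequentially"
    hence "\<forall>\<^sub>F n in sequentially. 1 \<le> real n * \<rho> n / ln (real n)"
      by (simp add: filterlim_at_top)
    moreover have "\<forall>\<^sub>F n in sequentially. 1 \<le> ln (real n)"
      using filterlim_compose[OF ln_at_top filterlim_real_sequentially] by (simp add: filterlim_at_top)
    ultimately show ?thesis
      by eventually_elim (simp add: le_divide_eq split: if_splits)
  qed
  thus ?thesis using eventually_ge_at_top[of 1]
  proof eventually_elim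
    case (elim n)
    have "real n * 1 \<le> real n * (real n * \<rho> n) powr (1/2)"
      using elim by (intro mult_left_mono ge_one_powr_ge_zero) auto
    also have "\<dots> = (real n powr 1 * real n powr (1/2)) * \<rho> n powr (1/2)"
      using elim pos[of n] by (simp add: powr_mult)
    also have "real n powr 1 * real n powr (1/2) = real n powr (3/2)"
      by (subst powr_add[symmetric]) simp
    finally show ?case by simp
  qed
qed

section \<open>The log likelihood ratio of an overfitted block model\<close>

theorem theorem2p7:
  fixes K Kplus :: nat
    and \<pi> :: "nat \<Rightarrow> real"
    and S :: "nat \<Rightarrow> nat \<Rightarrow> real"
    and \<rho> :: "nat \<Rightarrow> real"
  assumes K: "1 \<le> K" and Kplus: "K < Kplus"
    and S_sym: "\<And>a b. a \<in> {1..K} \<Longrightarrow> b \<in> {1..K} \<Longrightarrow> S a b = S b a"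
    and S_pos: "\<And>a b. a \<in> {1..K} \<Longrightarrow> b \<in> {1..K} \<Longrightarrow> 0 < S a b"
    and theta: "\<And>n. 1 \<le> n \<Longrightarrow> (\<pi>, \<lambda>a b. \<rho> n * S a b) \<in> Theta K"
    and columns: "\<And>n a b. 1 \<le> n \<Longrightarrow> a \<in> {1..K} \<Longrightarrow> b \<in> {1..K} \<Longrightarrow> a \<noteq> b \<Longrightarrow>
                    \<exists>c\<in>{1..K}. \<rho> n * S c a \<noteq> \<rho> n * S c b"
    and density: "\<rho> \<in> \<Omega>(\<lambda>_. 1) \<or>
                  (\<rho> \<longlonglongrightarrow> 0 \<and>
                   filterlim (\<lambda>n. real n * \<rho> n / ln (real n)) at_top sequentially)"
  shows "bigO_in_prob
           (\<lambda>n. sbm_pmf n K (\<pi>, \<lambda>a b. \<rho> n * S a b))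
           (\<lambda>n A. log_lik_ratio n K Kplus A)
           (\<lambda>n. real n powr (3/2) * \<rho> n powr (1/2))"
  unfolding bigO_in_prob_def
proof (intro allI impI exI[of _ "ln (real Kplus) + 1"] conjI)
  fix \<epsilon> :: real assume \<epsilon>: "0 < \<epsilon>"
  have "0 < \<rho> n" if "1 \<le> n" for n
  proof -
    have "0 < \<rho> n * S 1 1" using theta[OF that] K by (auto simp: Theta_def)
    thus ?thesis using S_pos[of 1 1] K by (simp add: zero_less_mult_iff)
  qed
  hence "\<forall>\<^sub>F n in sequentially. real n \<le> real n powr (3/2) * \<rho> n powr (1/2)"
    using density by (rule eventually_linear_le_rate)
  moreover have "\<forall>\<^sub>F n in sequentially. real (n\<^sup>2 + 1) ^ (2 * Kplus\<^sup>2) / exp (real n) < \<epsilon>"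
    by (rule order_tendstoD(2)[OF polynomial_over_exp_tendsto_0 \<epsilon>])
  ultimately show "\<forall>\<^sub>F n in sequentially.
      measure_pmf.prob (sbm_pmf n K (\<pi>, \<lambda>a b. \<rho> n * S a b))
        {A. (ln (real Kplus) + 1) * \<bar>real n powr (3/2) * \<rho> n powr (1/2)\<bar>
              < \<bar>log_lik_ratio n K Kplus A\<bar>} < \<epsilon>"
    using eventually_ge_at_top[of 1]
  proof eventually_elim
    case (elim n)
    show ?case
      using elim(1) by (intro le_less_trans[OF prob_abs_log_lik_ratio_gt[OF theta[OF elim(3)] K Kplus] elim(2)]) simp
  qed
next
  show "0 < ln (real Kplus) + 1" using K Kplus by (intro add_nonneg_pos ln_ge_zero) auto
qed

end
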